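(* Consider the $m$-person noncooperative game with strategy sets $X_k\subseteq\mathbb{R}^{r_k}$ and payoff tensors $\mathcal{A}^k$ ($k\in[m]$) described in the context, and suppose that every $X_k$ is closed and convex. Let $s_j:=\sum_{l=1}^{j-1}r_l$ for $j\in[m]$ (so $s_1=0$), and let $\mathcal{A}\in\mathbb{T}_{m,n}$, $n=\sum_{j\in[m]}r_j$, be the tensor whose entries are $$a_{(s_k+j_k)\,(s_1+j_1)\,\cdots\,(s_{k-1}+j_{k-1})\,(s_{k+1}+j_{k+1})\,\cdots\,(s_m+j_m)}=a^k_{j_1j_2\cdots j_m}\quad\text{for all }k\in[m]\text{ and all }j_l\in[r_l],\ l\in[m],$$ all other entries being zero. Then $\mathcal{A}x^{m-1}=\left(\nabla_{x^k}f_k(x^k,x^{-k})\right)_{k\in[m]}$ for all $x\in\mathbb{R}^n$, and a tuple $x^*=((x^1)^*,\ldots,(x^m)^* )$ is a Nash equilibrium point of the game if and only if $x^*\in X=\prod_{j\in[m]}X_j$ and $$\langle y-x^*,\mathcal{A}(x^* )^{m-1}\rangle\ge 0\quad\text{for all }y\in X,$$ i.e. $x^*$ solves TVI$(X,\mathcal{A},q)$ with $q=0$.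
   Context: $[m]:=\{1,\ldots,m\}$. The game has $m$ players, where $m$ and $r_1,\ldots,r_m$ are positive integers. For each $k\in[m]$, $x^k\in\mathbb{R}^{r_k}$ is player $k$'s strategy and $X_k\subseteq\mathbb{R}^{r_k}$ is his (nonempty) strategy set. Write $n=\sum_{j\in[m]}r_j$, $x=(x^j)_{j\in[m]}\in\mathbb{R}^{r_1}\times\cdots\times\mathbb{R}^{r_m}=\mathbb{R}^n$, $x^{-k}=(x^j)_{j\in[m]\setminus\{k\}}$. Player $k$ has a payoff tensor $\mathcal{A}^k=(a^k_{i_1i_2\cdots i_m})$ with real entries, $i_j\in[r_j]$ for $j\in[m]$, and his cost function is $f_k(x^k,x^{-k})=\sum_{i_1=1}^{r_1}\cdots\sum_{i_m=1}^{r_m}a^k_{i_1i_2\cdots i_m}x^1_{i_1}x^2_{i_2}\cdots x^m_{i_m}$; $\nabla_{x^k}f_k$ denotes its gradient with respect to $x^k$. A tuple $x^*=((x^1)^*,\ldots,(x^m)^* )$ is a Nash equilibrium point of the game if, for every $k\in[m]$, $(x^k)^*\in\arg\min_{x^k\in X_k}f_k(x^k,(x^* )^{-k})$, where $(x^* )^{-k}=((x^j)^* )_{j\in[m]\setminus\{k\}}$. $\mathbb{T}_{m,n}$ is the set of $m$-order $n$-dimensional real tensors $\mathcal{A}=(a_{i_1\cdots i_m})$, $i_1,\ldots,i_m\in[n]$, and $\mathcal{A}x^{m-1}\in\mathbb{R}^n$ has components $(\mathcal{A}x^{m-1})_i=\sum_{i_2,\ldots,i_m=1}^n a_{ii_2\cdots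 i_m}x_{i_2}\cdots x_{i_m}$. TVI$(X,\mathcal{A},q)$ is the problem of finding $x^*\in X$ such that $\langle y-x^*,\mathcal{A}(x^* )^{m-1}+q\rangle\ge 0$ for all $y\in X$. *)

theory Defs
  imports "HOL-Analysis.Analysis" "HOL-Library.Function_Algebras"
begin

text \<open>
  The dimensions \<open>r\<^sub>1, \<dots>, r\<^sub>m\<close> and \<open>n = \<Sum>j. r\<^sub>j\<close> vary with the data, so \<open>\<real>\<^sup>n\<close> is the
  space \<^term>\<open>Euclidean_space n\<close> of sequences vanishing from position \<open>n\<close> on. Players,
  coordinates and tensor indices are counted from \<open>0\<close>: the player \<open>k \<in> [m]\<close> becomes
  \<open>k < m\<close>, the coordinate \<open>j \<in> [r]\<close> becomes \<open>j < r\<close>.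
\<close>

instantiation "fun" :: (type, real_vector) real_vector
begin

definition scaleR_fun :: "real \<Rightarrow> ('a \<Rightarrow> 'b) \<Rightarrow> 'a \<Rightarrow> 'b"
  where "scaleR_fun c f = (\<lambda>i. c *\<^sub>R f i)"

instance
  by standard (simp_all add: scaleR_fun_def fun_eq_iff scaleR_add_right scaleR_add_left)

end

abbreviation Rn :: "nat \<Rightarrow> (nat \<Rightarrow> real) set"
  where "Rn n \<equiv> topspace (Euclidean_space n)"

definition inner_Rn :: "nat \<Rightarrow> (nat \<Rightarrow> real) \<Rightarrow> (nat \<Rightarrow> real) \<Rightarrow> real"
  where "inner_Rn n x y = (\<Sum>i<n. x i * y i)"

text \<open>\<open>f\<close> is Frechet differentiable at \<open>x\<close> as a function on \<open>\<real>\<^sup>n\<close>, with gradient \<open>g\<close>.\<close>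

definition has_gradient ::
    "nat \<Rightarrow> ((nat \<Rightarrow> real) \<Rightarrow> real) \<Rightarrow> (nat \<Rightarrow> real) \<Rightarrow> (nat \<Rightarrow> real) \<Rightarrow> bool"
  where "has_gradient n f x g \<longleftrightarrow> g \<in> Rn n \<and>
    (\<forall>e>0. \<exists>d>0. \<forall>h\<in>Rn n. L2_set h {..<n} < d \<longrightarrow>
      \<bar>f (x + h) - f x - inner_Rn n g h\<bar> \<le> e * L2_set h {..<n})"

definition gradient ::
    "nat \<Rightarrow> ((nat \<Rightarrow> real) \<Rightarrow> real) \<Rightarrow> (nat \<Rightarrow> real) \<Rightarrow> nat \<Rightarrow> real"
  where "gradient n f x = (THE g. has_gradient n f x g)"


text \<open>
  Index tuples are lists: the tensor \<open>A \<in> \<T>\<^bsub>m,n\<^esub>\<close> has the entries \<open>A is\<close> with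
  \<open>is \<in> tensor_indices m n\<close>; the values on other lists are irrelevant.
\<close>

definition tensor_indices :: "nat \<Rightarrow> nat \<Rightarrow> nat list set"
  where "tensor_indices m n = {is. length is = m \<and> set is \<subseteq> {..<n}}"

text \<open>The vector \<open>\<A>x\<^bsup>m-1\<^esup> \<in> \<real>\<^sup>n\<close>.\<close>

definition tensor_apply ::
    "nat \<Rightarrow> nat \<Rightarrow> (nat list \<Rightarrow> real) \<Rightarrow> (nat \<Rightarrow> real) \<Rightarrow> nat \<Rightarrow> real"
  where "tensor_apply m n A x = (\<lambda>i. if i < n
    then \<Sum>is\<in>tensor_indices (m - 1) n. A (i # is) * prod_list (map x is) else 0)"

text \<open>\<open>x\<close> is a solution of the tensor variational inequality \<open>TVI(X, \<A>, q)\<close>.\<close>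

definition solves_TVI ::
    "nat \<Rightarrow> nat \<Rightarrow> (nat \<Rightarrow> real) set \<Rightarrow> (nat list \<Rightarrow> real) \<Rightarrow> (nat \<Rightarrow> real) \<Rightarrow> (nat \<Rightarrow> real) \<Rightarrow> bool"
  where "solves_TVI m n X A q x \<longleftrightarrow>
    x \<in> X \<and> (\<forall>y\<in>X. inner_Rn n (y - x) (tensor_apply m n A x + q) \<ge> 0)"


definition payoff_indices :: "nat \<Rightarrow> (nat \<Rightarrow> nat) \<Rightarrow> nat list set"
  where "payoff_indices m r = {js. length js = m \<and> (\<forall>l<m. js ! l < r l)}"

text \<open>The cost \<open>f\<^sub>k(x\<^sup>k, x\<^sup>-\<^sup>k)\<close> for \<open>b = \<A>\<^sup>k\<close>, where \<open>x l\<close> is the strategy of player \<open>l\<close>.\<close>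

definition cost :: "nat \<Rightarrow> (nat \<Rightarrow> nat) \<Rightarrow> (nat list \<Rightarrow> real) \<Rightarrow> (nat \<Rightarrow> nat \<Rightarrow> real) \<Rightarrow> real"
  where "cost m r b x = (\<Sum>js\<in>payoff_indices m r. b js * (\<Prod>l<m. x l (js ! l)))"

definition Nash_equilibrium ::
    "nat \<Rightarrow> (nat \<Rightarrow> nat) \<Rightarrow> (nat \<Rightarrow> nat list \<Rightarrow> real) \<Rightarrow> (nat \<Rightarrow> (nat \<Rightarrow> real) set) \<Rightarrow>
      (nat \<Rightarrow> nat \<Rightarrow> real) \<Rightarrow> bool"
  where "Nash_equilibrium m r a X x \<longleftrightarrow>
    (\<forall>k<m. is_arg_min (\<lambda>y. cost m r (a k) (x(k := y))) (\<lambda>y. y \<in> X k) (x k))"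


definition offset :: "(nat \<Rightarrow> nat) \<Rightarrow> nat \<Rightarrow> nat"
  where "offset r k = (\<Sum>l<k. r l)"

text \<open>The identification of \<open>\<real>\<^bsup>r\<^sub>1\<^esup> \<times> \<dots> \<times> \<real>\<^bsup>r\<^sub>m\<^esup>\<close> with \<open>\<real>\<^sup>n\<close> (see \<open>bij_betw_stack\<close> below).\<close>

definition stack :: "nat \<Rightarrow> (nat \<Rightarrow> nat) \<Rightarrow> (nat \<Rightarrow> nat \<Rightarrow> real) \<Rightarrow> nat \<Rightarrow> real"
  where "stack m r x = (\<lambda>i. \<Sum>k<m. \<Sum>j<r k. if i = offset r k + j then x k j else 0)"

text \<open>
  The position \<open>(s\<^sub>k+j\<^sub>k)(s\<^sub>1+j\<^sub>1)\<cdots>(s\<^sub>m+j\<^sub>m)\<close> at which the entry of \<open>\<A>\<^sup>k\<close> with index \<open>js\<close>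
  is placed: player \<open>k\<close> comes first, the others follow in increasing order.
\<close>

definition game_index :: "nat \<Rightarrow> (nat \<Rightarrow> nat) \<Rightarrow> nat \<Rightarrow> nat list \<Rightarrow> nat list"
  where "game_index m r k js = map (\<lambda>l. offset r l + js ! l) (k # [0..<k] @ [Suc k..<m])"

definition is_game_tensor ::
    "nat \<Rightarrow> (nat \<Rightarrow> nat) \<Rightarrow> (nat \<Rightarrow> nat list \<Rightarrow> real) \<Rightarrow> (nat list \<Rightarrow> real) \<Rightarrow> bool"
  where "is_game_tensor m r a A \<longleftrightarrow>
    (\<forall>k<m. \<forall>js\<in>payoff_indices m r. A (game_index m r k js) = a k js) \<and>
    (\<forall>is\<in>tensor_indices m (offset r m) - (\<Union>k<m. game_index m r k ` payoff_indices m r).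
      A is = 0)"

lemma offset_add_less:
  assumes "k < l" "j < r k"
  shows "offset r k + j < offset r l"
proof -
  have "offset r k + j < offset r (Suc k)"
    using assms by (simp add: offset_def)
  also have "\<dots> \<le> offset r l"
    unfolding offset_def using assms by (intro sum_mono2) auto
  finally show ?thesis .
qed

lemma offset_add_inj:
  assumes "offset r k + j = offset r l + i" "j < r k" "i < r l"
  shows "k = l \<and> j = i"
proof -
  have "\<not> k < l" "\<not> l < k"
    using offset_add_less[of k l j r] offset_add_less[of l k i r] assms by auto
  with assms show ?thesis by auto
qed

lemma offset_add_cases:
  assumes "i < offset r m"
  shows "\<exists>k<m. \<exists>j<r k. i = offset r k + j"
  using assms
proof (induction m)
  case 0
  then show ?case by (simp add: offset_def)
next
  case (Suc m)
  show ?case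
  proof (cases "i < offset r m")
    case True
    with Suc.IH show ?thesis using less_SucI by blast
  next
    case False
    with Suc.prems have "i - offset r m < r m" "i = offset r m + (i - offset r m)"
      by (auto simp: offset_def)
    then show ?thesis by blast
  qed
qed

lemma stack_offset_add:
  assumes "k < m" "j < r k"
  shows "stack m r x (offset r k + j) = x k j"
proof -
  have "stack m r x (offset r k + j) =
      (\<Sum>l<m. \<Sum>i<r l. if l = k \<and> i = j then x l i else 0)"
    unfolding stack_def
  proof (intro sum.cong refl if_cong)
    fix l i assume "i \<in> {..<r l}"
    then show "offset r k + j = offset r l + i \<longleftrightarrow> l = k \<and> i = j"
      using offset_add_inj[of r k j l i] assms by auto
  qed
  also have "\<dots> = (\<Sum>l<m. if l = k then (\<Sum>i<r l. if i = j then x l i else 0) else 0)"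
    by (intro sum.cong) auto
  also have "\<dots> = x k j"
    using assms by simp
  finally show ?thesis .
qed

lemma stack_in_Rn: "stack m r x \<in> Rn (offset r m)"
  unfolding topspace_Euclidean_space mem_Collect_eq
proof (intro allI impI)
  fix i assume "offset r m \<le> i"
  then show "stack m r x i = 0"
    unfolding stack_def by (intro sum.neutral ballI) (use offset_add_less in fastforce)
qed

lemma bij_betw_stack:
  "bij_betw (stack m r) (\<Pi>\<^sub>E k\<in>{..<m}. Rn (r k)) (Rn (offset r m))"
  unfolding bij_betw_def
proof (intro conjI equalityI subsetI)
  show "inj_on (stack m r) (\<Pi>\<^sub>E k\<in>{..<m}. Rn (r k))"
  proof (rule inj_onI)
    fix x y
    assume xy: "x \<in> (\<Pi>\<^sub>E k\<in>{..<m}. Rn (r k))" "y \<in> (\<Pi>\<^sub>E k\<in>{..<m}. Rn (r k))"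
      and eq: "stack m r x = stack m r y"
    have "x k = y k" if k: "k \<in> {..<m}" for k
    proof
      fix j
      show "x k j = y k j"
      proof (cases "j < r k")
        case True
        with k eq show ?thesis by (metis lessThan_iff stack_offset_add)
      next
        case False
        with k xy have "x k j = 0" "y k j = 0"
          by (auto simp: topspace_Euclidean_space PiE_iff)
        then show ?thesis by simp
      qed
    qed
    with xy show "x = y" by (rule PiE_ext)
  qed
next
  fix v assume "v \<in> stack m r ` (\<Pi>\<^sub>E k\<in>{..<m}. Rn (r k))"
  then show "v \<in> Rn (offset r m)" using stack_in_Rn by auto
next
  fix v assume v: "v \<in> Rn (offset r m)"
  define x where
    "x = (\<lambda>k\<in>{..<m}. \<lambda>j. if j < r k then v (offset r k + j) else 0)"
  have "x \<in> (\<Pi>\<^sub>E k\<in>{..<m}. Rn (r k))"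
    by (auto simp: x_def topspace_Euclidean_space)
  moreover have "stack m r x = v"
  proof
    fix i
    show "stack m r x i = v i"
    proof (cases "i < offset r m")
      case True
      then obtain k j where "k < m" "j < r k" "i = offset r k + j"
        using offset_add_cases by blast
      then show ?thesis by (simp add: stack_offset_add x_def)
    next
      case False
      then show ?thesis
        using v stack_in_Rn[of m r x] by (simp add: topspace_Euclidean_space)
    qed
  qed
  ultimately show "v \<in> stack m r ` (\<Pi>\<^sub>E k\<in>{..<m}. Rn (r k))" by blast
qed

text \<open>Different entries of the payoff tensors are placed at different positions.\<close>

lemma game_index_inj:
  assumes "game_index m r k js = game_index m r l is" "k < m" "l < m"
    "js \<in> payoff_indices m r" "is \<in> payoff_indices m r"
  shows "k = l \<and> js = is"
proof -
  have kl: "k = l" "js ! k = is ! k"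
    using assms offset_add_inj[of r k "js ! k" l "is ! l"]
    by (auto simp: game_index_def payoff_indices_def)
  have "js ! i = is ! i" if "i < m" for i
  proof -
    have "i \<in> set (k # [0..<k] @ [Suc k..<m])" using that by auto
    moreover have "\<forall>i\<in>set (k # [0..<k] @ [Suc k..<m]). offset r i + js ! i = offset r i + is ! i"
      using assms(1) kl unfolding game_index_def map_eq_conv[symmetric] by simp
    ultimately have "offset r i + js ! i = offset r i + is ! i" by blast
    then show ?thesis by simp
  qed
  then show ?thesis
    using kl assms(4,5) by (auto simp: payoff_indices_def intro: nth_equalityI)
qed

lemma ex_game_tensor: "\<exists>A. is_game_tensor m r a A"
proof -
  let ?S = "{..<m} \<times> payoff_indices m r" and ?g = "\<lambda>(k, js). game_index m r k js"
  have inj: "inj_on ?g ?S"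
    by (auto intro!: inj_onI dest: game_index_inj)
  define A where
    "A is = (if is \<in> ?g ` ?S then case_prod a (the_inv_into ?S ?g is) else 0)" for "is"
  have "A (game_index m r k js) = a k js" if "k < m" "js \<in> payoff_indices m r" for k js
  proof -
    have "(k, js) \<in> ?S" using that by simp
    then have "A (?g (k, js)) = case_prod a (k, js)"
      unfolding A_def using the_inv_into_f_f[OF inj, of "(k, js)"] by (simp only: imageI if_True)
    then show ?thesis by simp
  qed
  moreover have "A is = 0" if "is \<notin> (\<Union>k<m. game_index m r k ` payoff_indices m r)" for "is"
    using that by (auto simp: A_def)
  ultimately have "is_game_tensor m r a A"
    unfolding is_game_tensor_def by blast
  then show ?thesis by blast
qed

end

theory Submission
  imports Defs
begin

text \<open>
  Player \<open>k\<close>'s cost is linear in his own strategy: it is the inner product with a vector \<open>g\<^sub>k\<close>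
  that depends on the other strategies only. Hence \<open>g\<^sub>k\<close> is the gradient, and being a best reply
  is the inequality \<open>\<langle>z - x\<^sup>k, g\<^sub>k\<rangle> \<ge> 0\<close> for all \<open>z \<in> X\<^sub>k\<close>. Collecting the terms of
  \<open>\<A>x\<^bsup>m-1\<^esup>\<close> shows that its \<open>k\<close>-th block is \<open>g\<^sub>k\<close>. The variational inequality on the product
  splits into these block inequalities, as one may vary a single block at a time.
\<close>

section \<open>Inner products of stacked vectors, computed block by block\<close>

lemma inner_Rn_diff_left: "inner_Rn n (x - y) z = inner_Rn n x z - inner_Rn n y z"
  by (simp add: inner_Rn_def left_diff_distrib sum_subtractf)

lemma inner_Rn_add_right: "inner_Rn n x (y + z) = inner_Rn n x y + inner_Rn n x z"
  by (simp add: inner_Rn_def distrib_left sum.distrib)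

lemma inner_Rn_commute: "inner_Rn n x y = inner_Rn n y x"
  by (simp add: inner_Rn_def mult.commute)

text \<open>The blocks of length \<open>r k\<close> starting at \<open>offset r k\<close> tile the
  interval below \<open>offset r m\<close>; the induction appends the last block.\<close>

lemma sum_offset_blocks: "(\<Sum>i<offset r m. f i) = (\<Sum>k<m. \<Sum>j<r k. f (offset r k + j))"
proof (induction m)
  case 0
  then show ?case by (simp add: offset_def)
next
  case (Suc m)
  have "offset r (Suc m) = offset r m + r m"
    by (simp add: offset_def)
  moreover have "(\<Sum>i<offset r m + r m. f i) = (\<Sum>i<offset r m. f i) + (\<Sum>j<r m. f (offset r m + j))"
    using sum.atLeastLessThan_concat[of 0 "offset r m" "offset r m + r m" f]
      sum.shift_bounds_nat_ivl[of f 0 "offset r m" "r m"]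
    by (simp add: atLeast0LessThan add.commute)
  ultimately show ?case using Suc.IH by simp
qed

lemma inner_Rn_stack:
  "inner_Rn (offset r m) (stack m r x) (stack m r y) = (\<Sum>k<m. inner_Rn (r k) (x k) (y k))"
  unfolding inner_Rn_def sum_offset_blocks
  by (intro sum.cong refl) (simp add: stack_offset_add)

section \<open>Uniqueness of gradients, and gradients of linear functions\<close>

text \<open>Comparing both expansions along a small multiple of a unit vector bounds each coordinate
  of the difference by every \<open>e > 0\<close>. From position \<open>n\<close> on both vectors
  vanish.\<close>

lemma has_gradient_unique:
  assumes "has_gradient n f x g" "has_gradient n f x g'"
  shows "g = g'"
proof
  fix i
  show "g i = g' i"
  proof (cases "i < n")
    case False
    then show ?thesis using assms by (simp add: has_gradient_def topspace_Euclidean_space)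
  next
    case True
    have "\<bar>g i - g' i\<bar> \<le> 0 + e" if "e > 0" for e
    proof -
      from that have e: "e / 2 > 0" by simp
      obtain d where d: "d > 0" "\<And>h. h \<in> Rn n \<Longrightarrow> L2_set h {..<n} < d \<Longrightarrow>
          \<bar>f (x + h) - f x - inner_Rn n g h\<bar> \<le> e / 2 * L2_set h {..<n}"
        using assms(1) e unfolding has_gradient_def by meson
      obtain d' where d': "d' > 0" "\<And>h. h \<in> Rn n \<Longrightarrow> L2_set h {..<n} < d' \<Longrightarrow>
          \<bar>f (x + h) - f x - inner_Rn n g' h\<bar> \<le> e / 2 * L2_set h {..<n}"
        using assms(2) e unfolding has_gradient_def by meson
      \<comment> \<open>Half of the smaller radius keeps the norm of \<open>h\<close> strictly below
        both.\<close>
      define t where "t = min d d' / 2"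
      have t: "0 < t" "t < d" "t < d'" using d(1) d'(1) by (auto simp: t_def)
      define h where "h = (\<lambda>j. if j = i then t else 0)"
      have h: "h \<in> Rn n" using True by (auto simp: h_def topspace_Euclidean_space)
      have norm: "L2_set h {..<n} = t"
        using True t by (simp add: L2_set_def h_def if_distrib[of "\<lambda>v. v\<^sup>2"] cong: if_cong)
      have inner: "inner_Rn n v h = v i * t" for v
        using True by (simp add: inner_Rn_def h_def if_distrib cong: if_cong)
      have "\<bar>f (x + h) - f x - g i * t\<bar> \<le> e / 2 * t" "\<bar>f (x + h) - f x - g' i * t\<bar> \<le> e / 2 * t"
        using d(2)[OF h] d'(2)[OF h] t norm inner by simp_all
      \<comment> \<open>The common increment of \<open>f\<close> cancels, and the two errors
        \<open>e / 2 * t\<close> add up.\<close>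
      then have "\<bar>g i * t - g' i * t\<bar> \<le> e * t" by linarith
      then have "\<bar>g i - g' i\<bar> * t \<le> e * t"
        using t by (simp add: abs_mult flip: left_diff_distrib)
      then show ?thesis using t by simp
    qed
    then have "\<bar>g i - g' i\<bar> \<le> 0" by (rule field_le_epsilon)
    then show ?thesis by simp
  qed
qed

lemma gradient_eqI: "has_gradient n f x g \<Longrightarrow> gradient n f x = g"
  unfolding gradient_def by (blast intro: has_gradient_unique)

text \<open>The remainder is identically zero, so \<open>d = 1\<close> serves for every
  \<open>e\<close>.\<close>

lemma has_gradient_linear:
  assumes "g \<in> Rn n" "\<And>y. f y = inner_Rn n g y"
  shows "has_gradient n f x g"
  unfolding has_gradient_def
  using assms by (auto simp: inner_Rn_add_right intro!: exI[of _ 1])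

section \<open>Costs as linear functions of the player's own strategy\<close>

text \<open>The vector of partial derivatives with respect to the strategy of player
  \<open>k\<close>: the product omits the factor of \<open>k\<close>, so \<open>x k\<close> has no
  influence. The value \<open>0\<close> from position \<open>r k\<close> on places it in
  \<open>Rn (r k)\<close>.\<close>

definition own_gradient ::
    "nat \<Rightarrow> (nat \<Rightarrow> nat) \<Rightarrow> (nat list \<Rightarrow> real) \<Rightarrow> nat \<Rightarrow> (nat \<Rightarrow> nat \<Rightarrow> real) \<Rightarrow> nat \<Rightarrow> real"
  where "own_gradient m r b k x = (\<lambda>j. if j < r k
    then \<Sum>js | js \<in> payoff_indices m r \<and> js ! k = j. b js * (\<Prod>l\<in>{..<m} - {k}. x l (js ! l))
    else 0)"

lemma own_gradient_in_Rn: "own_gradient m r b k x \<in> Rn (r k)"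
  by (simp add: own_gradient_def topspace_Euclidean_space)

lemma finite_payoff_indices: "finite (payoff_indices m r)"
proof (rule finite_subset)
  \<comment> \<open>The components have different bounds; the sum of all dimensions is a common
    one.\<close>
  show "payoff_indices m r \<subseteq> {js. set js \<subseteq> {..<offset r m} \<and> length js = m}"
  proof (clarsimp simp: payoff_indices_def in_set_conv_nth)
    fix js l
    assume "\<forall>l<length js. js ! l < r l" "l < length js"
    then show "js ! l < offset r (length js)"
      using offset_add_less[of l "length js" "js ! l" r] by simp
  qed
qed (simp add: finite_lists_length_eq)

text \<open>Each monomial has exactly one factor from player \<open>k\<close>, namely
  \<open>y (js ! k)\<close>. Grouping the index tuples by \<open>js ! k\<close> collects the
  coefficient of each coordinate of \<open>y\<close>.\<close>

lemma cost_linear: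
  assumes "k < m"
  shows "cost m r b (x(k := y)) = inner_Rn (r k) (own_gradient m r b k x) y"
proof -
  let ?P = "payoff_indices m r" and ?p = "\<lambda>js. \<Prod>l\<in>{..<m} - {k}. x l (js ! l)"
  have "cost m r b (x(k := y)) = (\<Sum>js\<in>?P. b js * ?p js * y (js ! k))"
    unfolding cost_def
    using assms by (intro sum.cong refl) (simp add: prod.remove[of "{..<m}" k])
  also have "\<dots> = (\<Sum>j<r k. \<Sum>js | js \<in> ?P \<and> js ! k = j. b js * ?p js * y (js ! k))"
    using assms
    by (intro sum.group[symmetric] finite_payoff_indices) (auto simp: payoff_indices_def)
  also have "\<dots> = inner_Rn (r k) (own_gradient m r b k x) y"
    by (simp add: inner_Rn_def own_gradient_def sum_distrib_right)
  finally show ?thesis .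
qed

lemma has_gradient_cost:
  assumes "k < m"
  shows "has_gradient (r k) (\<lambda>y. cost m r b (x(k := y))) z (own_gradient m r b k x)"
  using assms by (intro has_gradient_linear own_gradient_in_Rn cost_linear)

section \<open>The blocks of the vector defined by the game tensor\<close>

text \<open>The leading index determines the player \<open>k\<close> and the coordinate
  \<open>j\<close>, so the nonzero entries of this row lie at the tails \<open>g js\<close> with
  \<open>js \<in> J\<close>. Reindexing the sum along \<open>g\<close> leaves the coefficients of
  \<open>own_gradient\<close>.\<close>

lemma tensor_apply_game_tensor:
  assumes A: "is_game_tensor m r a A" and k: "k < m" and j: "j < r k"
  shows "tensor_apply m (offset r m) A (stack m r x) (offset r k + j) = own_gradient m r (a k) k x j"
proof -
  define ls where "ls = [0..<k] @ [Suc k..<m]"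
  have ls: "set ls = {..<m} - {k}" "distinct ls" "length ls = m - 1"
    using k by (auto simp: ls_def)
  define J where "J = {js \<in> payoff_indices m r. js ! k = j}"
  define g where "g js = map (\<lambda>l. offset r l + js ! l) ls" for js
  have gi: "game_index m r k js = (offset r k + js ! k) # g js" for js
    by (simp add: game_index_def g_def ls_def)
  let ?T = "tensor_indices (m - 1) (offset r m)" and ?i = "offset r k + j"
  let ?F = "\<lambda>is. A (?i # is) * prod_list (map (stack m r x) is)"
  have i: "?i < offset r m" using k j by (rule offset_add_less)
  \<comment> \<open>All tuples in \<open>J\<close> share the component at \<open>k\<close>, so equal
    tails give equal full positions.\<close>
  have inj: "inj_on g J"
    using game_index_inj[of m r k _ k] k by (auto simp: inj_on_def J_def gi)
  have sub: "g ` J \<subseteq> ?T"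
    using ls by (auto simp: g_def J_def tensor_indices_def payoff_indices_def offset_add_less)
  have zero: "A (?i # is) = 0" if "is \<in> ?T - g ` J" for "is"
  proof -
    have "?i # is \<noteq> game_index m r l js" if "l < m" "js \<in> payoff_indices m r" for l js
    proof
      assume eq: "?i # is = game_index m r l js"
      \<comment> \<open>Comparing the leading entries suffices, since different blocks are
        disjoint.\<close>
      then have kl: "k = l \<and> j = js ! l"
        using that j by (intro offset_add_inj[of r]) (auto simp: game_index_def payoff_indices_def)
      then have "is = g js" using eq gi[of js] by simp
      then show False using that kl \<open>is \<in> ?T - g ` J\<close> by (simp add: J_def)
    qed
    \<comment> \<open>The length is right because \<open>k < m\<close> forces \<open>m > 0\<close>,
      so that \<open>Suc (m - 1) = m\<close>.\<close>
    moreover have "?i # is \<in> tensor_indices m (offset r m)"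
      using that i k by (auto simp: tensor_indices_def)
    ultimately show ?thesis using A unfolding is_game_tensor_def by blast
  qed
  have "finite ?T"
    using finite_lists_length_eq[of "{..<offset r m}" "m - 1"]
    by (simp add: tensor_indices_def conj_commute)
  then have "(\<Sum>is\<in>?T. ?F is) = (\<Sum>is\<in>g ` J. ?F is)"
    using sub zero by (intro sum.mono_neutral_right) auto
  also have "\<dots> = (\<Sum>js\<in>J. ?F (g js))"
    using inj by (simp add: sum.reindex)
  also have "\<dots> = (\<Sum>js\<in>J. a k js * (\<Prod>l\<in>{..<m} - {k}. x l (js ! l)))"
  proof (intro sum.cong refl arg_cong2[where f = "(*)"])
    fix js assume js: "js \<in> J"
    then show "A (?i # g js) = a k js"
      using A k by (auto simp: is_game_tensor_def J_def simp flip: gi)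
    have "prod_list (map (stack m r x) (g js)) = prod_list (map (\<lambda>l. x l (js ! l)) ls)"
      using js ls
      by (auto simp: g_def J_def payoff_indices_def stack_offset_add intro!: arg_cong[where f = prod_list])
    also have "\<dots> = (\<Prod>l\<in>{..<m} - {k}. x l (js ! l))"
      using ls by (simp flip: prod.distinct_set_conv_list)
    finally show "prod_list (map (stack m r x) (g js)) = (\<Prod>l\<in>{..<m} - {k}. x l (js ! l))" .
  qed
  finally show ?thesis
    using i j by (simp add: tensor_apply_def own_gradient_def J_def)
qed

lemma tensor_apply_game_tensor_stack:
  assumes "is_game_tensor m r a A"
  shows "tensor_apply m (offset r m) A (stack m r x) =
    stack m r (\<lambda>k. own_gradient m r (a k) k x)"
proof
  fix i
  show "tensor_apply m (offset r m) A (stack m r x) i =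
    stack m r (\<lambda>k. own_gradient m r (a k) k x) i"
  proof (cases "i < offset r m")
    case True
    then obtain k j where "k < m" "j < r k" "i = offset r k + j"
      using offset_add_cases by blast
    then show ?thesis using assms by (simp add: tensor_apply_game_tensor stack_offset_add)
  next
    case False
    then show ?thesis
      using stack_in_Rn[of m r] by (simp add: tensor_apply_def topspace_Euclidean_space)
  qed
qed

section \<open>Best replies and the variational inequality on the product\<close>

text \<open>By \<open>cost_linear\<close>, replacing \<open>x k\<close> by \<open>z\<close> changes
  the cost by exactly the inner product of \<open>z - x k\<close> with \<open>own_gradient\<close>;
  minimality says that this change is never negative.\<close>

lemma Nash_equilibrium_iff:
  "Nash_equilibrium m r a Xs x \<longleftrightarrow>
    (\<forall>k<m. x k \<in> Xs k \<and> (\<forall>z\<in>Xs k. inner_Rn (r k) (z - x k) (own_gradient m r (a k) k x) \<ge> 0))"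
proof -
  have "is_arg_min (\<lambda>y. cost m r (a k) (x(k := y))) (\<lambda>y. y \<in> Xs k) (x k) \<longleftrightarrow>
      x k \<in> Xs k \<and> (\<forall>z\<in>Xs k. inner_Rn (r k) (z - x k) (own_gradient m r (a k) k x) \<ge> 0)"
    if "k < m" for k
  proof -
    have "inner_Rn (r k) (z - x k) g = inner_Rn (r k) g z - inner_Rn (r k) g (x k)" for z g
      by (metis inner_Rn_diff_left inner_Rn_commute)
    then show ?thesis
      unfolding is_arg_min_def cost_linear[OF that] by (auto simp: not_less)
  qed
  then show ?thesis unfolding Nash_equilibrium_def by auto
qed

text \<open>Injectivity of \<open>stack\<close> on the product of the full spaces allows membership
  in the image to be checked block by block.\<close>

lemma stack_mem_image_PiE_iff:
  assumes "\<And>k. k < m \<Longrightarrow> Xs k \<subseteq> Rn (r k)" "x \<in> (\<Pi>\<^sub>E k\<in>{..<m}. Rn (r k))"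
  shows "stack m r x \<in> stack m r ` (\<Pi>\<^sub>E k\<in>{..<m}. Xs k) \<longleftrightarrow> (\<forall>k<m. x k \<in> Xs k)"
proof -
  have "(\<Pi>\<^sub>E k\<in>{..<m}. Xs k) \<subseteq> (\<Pi>\<^sub>E k\<in>{..<m}. Rn (r k))"
    using assms(1) by (intro PiE_mono) auto
  then have "stack m r x \<in> stack m r ` (\<Pi>\<^sub>E k\<in>{..<m}. Xs k) \<longleftrightarrow> x \<in> (\<Pi>\<^sub>E k\<in>{..<m}. Xs k)"
    using bij_betw_stack[of m r] assms(2)
    by (intro inj_on_image_mem_iff) (auto simp: bij_betw_def)
  then show ?thesis using assms(2) by (auto simp: PiE_iff)
qed

lemma product_variational_inequality_iff:
  assumes "x \<in> (\<Pi>\<^sub>E k\<in>{..<m}. Xs k)"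
  shows "(\<forall>y\<in>stack m r ` (\<Pi>\<^sub>E k\<in>{..<m}. Xs k).
      inner_Rn (offset r m) (y - stack m r x) (stack m r g) \<ge> 0) \<longleftrightarrow>
    (\<forall>k<m. \<forall>z\<in>Xs k. inner_Rn (r k) (z - x k) (g k) \<ge> 0)"
    (is "?L \<longleftrightarrow> ?R")
proof -
  have split: "inner_Rn (offset r m) (stack m r y - stack m r x) (stack m r g) =
      (\<Sum>k<m. inner_Rn (r k) (y k - x k) (g k))" for y
    by (simp add: inner_Rn_diff_left inner_Rn_stack sum_subtractf)
  show ?thesis
  proof
    assume L: ?L
    show ?R
    proof (intro allI impI ballI)
      fix k z assume k: "k < m" and z: "z \<in> Xs k"
      \<comment> \<open>This test point differs from \<open>x\<close> in block \<open>k\<close>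
        only, so every other summand of the split inner product vanishes.\<close>
      have "x(k := z) \<in> (\<Pi>\<^sub>E k\<in>{..<m}. Xs k)"
        using assms k z by (auto simp: PiE_iff extensional_def)
      then have "0 \<le> (\<Sum>l<m. inner_Rn (r l) ((x(k := z)) l - x l) (g l))"
        using L split by (metis imageI)
      also have "\<dots> = (\<Sum>l<m. if l = k then inner_Rn (r k) (z - x k) (g k) else 0)"
        by (intro sum.cong refl) (auto simp: inner_Rn_def)
      also have "\<dots> = inner_Rn (r k) (z - x k) (g k)"
        using k by simp
      finally show "inner_Rn (r k) (z - x k) (g k) \<ge> 0" .
    qed
  next
    assume ?R
    then show ?L by (auto simp: split PiE_iff intro!: sum_nonneg)
  qed
qed

theorem mainTheorem3:
  fixes m n :: nat and r :: "nat \<Rightarrow> nat"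
    and Xs :: "nat \<Rightarrow> (nat \<Rightarrow> real) set"
    and X :: "(nat \<Rightarrow> real) set"
    and a :: "nat \<Rightarrow> nat list \<Rightarrow> real"
    and A :: "nat list \<Rightarrow> real"
  assumes "m \<ge> 1"
    and "\<And>k. k < m \<Longrightarrow> r k \<ge> 1"
    and "n = (\<Sum>k<m. r k)"
    and "\<And>k. k < m \<Longrightarrow> Xs k \<subseteq> Rn (r k)"
    and "\<And>k. k < m \<Longrightarrow> Xs k \<noteq> {}"
    and "\<And>k. k < m \<Longrightarrow> closedin (Euclidean_space (r k)) (Xs k)"
    and "\<And>k. k < m \<Longrightarrow> convex (Xs k)"
    and "X = stack m r ` (\<Pi>\<^sub>E k\<in>{..<m}. Xs k)"
    and "is_game_tensor m r a A"
  shows "(\<forall>x\<in>\<Pi>\<^sub>E k\<in>{..<m}. Rn (r k).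
            (\<forall>k<m. \<exists>g. has_gradient (r k) (\<lambda>y. cost m r (a k) (x(k := y))) (x k) g) \<and>
            tensor_apply m n A (stack m r x) =
              stack m r (\<lambda>k. gradient (r k) (\<lambda>y. cost m r (a k) (x(k := y))) (x k)))
       \<and> (\<forall>x\<in>\<Pi>\<^sub>E k\<in>{..<m}. Rn (r k).
            (Nash_equilibrium m r a Xs x \<longleftrightarrow>
              stack m r x \<in> X \<and>
              (\<forall>y\<in>X. inner_Rn n (y - stack m r x) (tensor_apply m n A (stack m r x)) \<ge> 0)) \<and>
            (Nash_equilibrium m r a Xs x \<longleftrightarrow> solves_TVI m n X A 0 (stack m r x)))"
proof -
  have n: "n = offset r m"
    using assms(3) by (simp add: offset_def)
  have grad: "gradient (r k) (\<lambda>y. cost m r (a k) (x(k := y))) (x k) = own_gradient m r (a k) k x"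
    if "k < m" for k and x :: "nat \<Rightarrow> nat \<Rightarrow> real"
    by (intro gradient_eqI has_gradient_cost that)
  have apply_eq: "tensor_apply m n A (stack m r x) = stack m r (\<lambda>k. own_gradient m r (a k) k x)" for x
    unfolding n using assms(9) by (rule tensor_apply_game_tensor_stack)
  have stack_eq: "stack m r (\<lambda>k. own_gradient m r (a k) k x) =
      stack m r (\<lambda>k. gradient (r k) (\<lambda>y. cost m r (a k) (x(k := y))) (x k))" for x
    \<comment> \<open>Only blocks with \<open>k < m\<close> enter \<open>stack\<close>, and
      \<open>grad\<close> covers exactly these.\<close>
    unfolding stack_def by (intro ext sum.cong refl if_cong) (simp add: grad)
  have Nash: "Nash_equilibrium m r a Xs x \<longleftrightarrow> stack m r x \<in> X \<and>
      (\<forall>y\<in>X. inner_Rn n (y - stack m r x) (tensor_apply m n A (stack m r x)) \<ge> 0)"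
    if x: "x \<in> (\<Pi>\<^sub>E k\<in>{..<m}. Rn (r k))" for x
  proof -
    have mem: "stack m r x \<in> X \<longleftrightarrow> (\<forall>k<m. x k \<in> Xs k)"
      unfolding assms(8) by (rule stack_mem_image_PiE_iff[OF assms(4) x])
    show ?thesis
    proof (cases "\<forall>k<m. x k \<in> Xs k")
      case True
      then have "x \<in> (\<Pi>\<^sub>E k\<in>{..<m}. Xs k)"
        using x by (auto simp: PiE_iff)
      from product_variational_inequality_iff[OF this, of r "\<lambda>k. own_gradient m r (a k) k x"]
      show ?thesis
        using True mem by (simp add: Nash_equilibrium_iff apply_eq[unfolded n] assms(8) n)
    next
      \<comment> \<open>A tuple with an infeasible strategy satisfies neither side.\<close>
      case False
      then show ?thesis using mem unfolding Nash_equilibrium_iff by blast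
    qed
  qed
  show ?thesis
  proof (intro conjI ballI allI impI)
    fix x k assume "k < m"
    then show "\<exists>g. has_gradient (r k) (\<lambda>y. cost m r (a k) (x(k := y))) (x k) g"
      using has_gradient_cost by blast
  next
    fix x
    show "tensor_apply m n A (stack m r x) =
        stack m r (\<lambda>k. gradient (r k) (\<lambda>y. cost m r (a k) (x(k := y))) (x k))"
      unfolding apply_eq by (rule stack_eq)
  next
    fix x assume "x \<in> (\<Pi>\<^sub>E k\<in>{..<m}. Rn (r k))"
    from Nash[OF this]
    show "Nash_equilibrium m r a Xs x \<longleftrightarrow> stack m r x \<in> X \<and>
        (\<forall>y\<in>X. inner_Rn n (y - stack m r x) (tensor_apply m n A (stack m r x)) \<ge> 0)"
      and "Nash_equilibrium m r a Xs x \<longleftrightarrow> solves_TVI m n X A 0 (stack m r x)"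
      unfolding solves_TVI_def add_0_right by simp_all
  qed
qed

end
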